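(* Let $$A=\begin{pmatrix} 0 & 0 & 4 & 4 & 4 & 4 \\ 0 & 0 & 2 & 4 & 1 & 4 \\ 4 & 4 & 0 & 0 & 4 & 4 \\ 2 & 4 & 0 & 0 & 2 & 4 \\ 4 & 4 & 4 & 4 & 0 & 0 \\ 2 & 4 & 1 & 4 & 0 & 0 \end{pmatrix}\in\mathbb{R}^{6\times 6}.$$ Then the tropical rank of $A$ is $\mathrm{rk}_t(A)=4$ and the Kapranov rank of $A$ is $\mathrm{rk}_K(A)=5$.
   Context: Tropical matrices are matrices with entries in $\mathbb{R}$, regarded over the tropical semiring $(\mathbb{R},\oplus,\otimes)$ with $a\oplus b=\min\{a,b\}$ and $a\otimes b=a+b$. Tropical rank. The permanent of $S=(s_{ij})\in\mathbb{R}^{n\times n}$ is $\mathrm{perm}(S)=\min_{\sigma\in \mathcal{S}_n}\{s_{1,\sigma(1)}+\cdots+s_{n,\sigma(n)}\}$, where $\mathcal{S}_n$ is the symmetric group on $\{1,\dots,n\}$. The matrix $S$ is tropically singular if this minimum is attained by at least two permutations $\sigma$; otherwise $S$ is tropically non-singular. The tropical rank $\mathrm{rk}_t(M)$ of $M\in\mathbb{R}^{p\times q}$ is the largest integer $r$ such that $M$ has a tropically non-singular $r\times r$ submatrix (obtained by choosing $r$ rows and $r$ columns of $M$). Kapranov rank. Let $\mathbf{K}$ be the field of formal sums $a(t)=\sum_{i=1}^{\infty}a_i t^{\alpha_i}$ with $a_i\in\mathbb{C}$, with exponents $\alpha_i\in\mathbb{R}$ (pairwise distinct), and with $\lim_{i\to\infty}\alpha_i=+\infty$,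 under the usual addition and multiplication of series. For $a\in\mathbf{K}\setminus\{0\}$ put $\deg(a)=\min\{\alpha_n : a_n\neq 0\}$, and put $\deg(0)=\infty$. A matrix $B=(b_{ij})\in\mathbf{K}^{m\times n}$ is a lift of $T=(t_{ij})\in\mathbb{R}^{m\times n}$ if $\deg(b_{ij})=t_{ij}$ for all $i,j$. The Kapranov rank $\mathrm{rk}_K(M)$ of $M\in\mathbb{R}^{m\times n}$ is the minimum, over all lifts $B$ of $M$, of the usual rank of $B$ over the field $\mathbf{K}$. *)

theory Defs
  imports
    "HOL-Library.Extended_Real"
    "Jordan_Normal_Form.DL_Rank_Submatrix"
begin

text \<open>Tropical matrices are matrices over \<^typ>\<open>real\<close>; rows and columns are indexed from 0.\<close>

subsection \<open>Tropical rank\<close>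

definition perm_weight :: "real mat \<Rightarrow> (nat \<Rightarrow> nat) \<Rightarrow> real" where
  "perm_weight S \<sigma> = (\<Sum>i<dim_row S. S $$ (i, \<sigma> i))"

definition trop_perm :: "real mat \<Rightarrow> real" where
  "trop_perm S = Min (perm_weight S ` {\<sigma>. \<sigma> permutes {..<dim_row S}})"

definition trop_singular :: "real mat \<Rightarrow> bool" where
  "trop_singular S \<longleftrightarrow>
     (\<exists>\<sigma> \<tau>. \<sigma> permutes {..<dim_row S} \<and> \<tau> permutes {..<dim_row S} \<and> \<sigma> \<noteq> \<tau> \<and>
            perm_weight S \<sigma> = trop_perm S \<and> perm_weight S \<tau> = trop_perm S)"

definition trop_rank :: "real mat \<Rightarrow> nat" where
  "trop_rank M = Max {r. \<exists>I J. I \<subseteq> {..<dim_row M} \<and> J \<subseteq> {..<dim_col M} \<and>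
                          card I = r \<and> card J = r \<and> \<not> trop_singular (submatrix M I J)}"

subsection \<open>The field of formal series with real exponents\<close>

text \<open>
  A series is represented by its coefficient function, mapping the exponent \<open>x\<close> to the
  coefficient of \<open>t\<close> to the power \<open>x\<close>. The functions arising from sequences of coefficients and
  of pairwise distinct exponents tending to infinity are exactly those with only finitely many
  nonzero values below each bound; this is \<open>left_finite_iff_sequence\<close> below.
\<close>

definition left_finite :: "(real \<Rightarrow> complex) \<Rightarrow> bool" where
  "left_finite f \<longleftrightarrow> (\<forall>c. finite {x. x \<le> c \<and> f x \<noteq> 0})"

lemma left_finite_iff_sequence:
  "left_finite f \<longleftrightarrow>
     (\<exists>(a :: nat \<Rightarrow> complex) \<alpha>. inj \<alpha> \<and> filterlim \<alpha> at_top sequentially \<and>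
        (\<forall>i. f (\<alpha> i) = a i) \<and> (\<forall>x. x \<notin> range \<alpha> \<longrightarrow> f x = 0))"
proof
  assume lf: "left_finite f"
  define S where "S = {x. f x \<noteq> 0} \<union> range real"
  have fin: "finite {x \<in> S. x \<le> c}" for c
  proof -
    have "{x \<in> S. x \<le> c} \<subseteq> {x. x \<le> c \<and> f x \<noteq> 0} \<union> real ` {..nat \<lfloor>c\<rfloor>}"
      unfolding S_def by (auto simp: le_nat_floor)
    moreover have "finite {x. x \<le> c \<and> f x \<noteq> 0}" using lf by (simp add: left_finite_def)
    ultimately show ?thesis by (meson finite_UnI finite_atMost finite_imageI finite_subset)
  qed
  have eq: "S = (\<Union>n::nat. {x \<in> S. x \<le> real n})"
    using real_arch_simple by auto
  have "countable (\<Union>n::nat. {x \<in> S. x \<le> real n})"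
    by (intro countable_UN countable_finite fin countableI_type)
  with eq have cnt: "countable S" by metis
  have inf: "infinite S"
    unfolding S_def by (simp add: finite_image_iff inj_on_def)
  define \<alpha> where "\<alpha> = from_nat_into S"
  have bij: "bij_betw \<alpha> UNIV S"
    unfolding \<alpha>_def by (rule bij_betw_from_nat_into[OF cnt inf])
  have inj: "inj \<alpha>" and ran: "range \<alpha> = S" using bij by (auto simp: bij_betw_def)
  have "filterlim \<alpha> at_top sequentially"
    unfolding filterlim_at_top
  proof
    fix c
    have "\<alpha> ` {i. \<alpha> i \<le> c} \<subseteq> {x \<in> S. x \<le> c}" using ran by auto
    then have "finite (\<alpha> ` {i. \<alpha> i \<le> c})" using fin finite_subset by blast
    then have "finite {i. \<alpha> i \<le> c}"
      using inj by (metis finite_imageD inj_on_subset subset_UNIV)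
    then have "\<forall>\<^sub>F i in cofinite. \<not> \<alpha> i \<le> c" by (simp add: eventually_cofinite)
    then show "\<forall>\<^sub>F i in sequentially. c \<le> \<alpha> i"
      unfolding cofinite_eq_sequentially by (rule eventually_mono) simp
  qed
  moreover have "\<forall>x. x \<notin> range \<alpha> \<longrightarrow> f x = 0" using ran by (auto simp: S_def)
  ultimately show "\<exists>(a :: nat \<Rightarrow> complex) \<alpha>. inj \<alpha> \<and> filterlim \<alpha> at_top sequentially \<and>
        (\<forall>i. f (\<alpha> i) = a i) \<and> (\<forall>x. x \<notin> range \<alpha> \<longrightarrow> f x = 0)"
    using inj by (intro exI[of _ "f \<circ> \<alpha>"] exI[of _ \<alpha>]) auto
next
  assume "\<exists>(a :: nat \<Rightarrow> complex) \<alpha>. inj \<alpha> \<and> filterlim \<alpha> at_top sequentially \<and>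
        (\<forall>i. f (\<alpha> i) = a i) \<and> (\<forall>x. x \<notin> range \<alpha> \<longrightarrow> f x = 0)"
  then obtain \<alpha> :: "nat \<Rightarrow> real" where lim: "filterlim \<alpha> at_top sequentially"
    and zero: "\<And>x. x \<notin> range \<alpha> \<Longrightarrow> f x = 0" by blast
  show "left_finite f" unfolding left_finite_def
  proof
    fix c
    have "\<forall>\<^sub>F i in sequentially. \<not> \<alpha> i \<le> c"
      using lim unfolding filterlim_at_top_dense by (auto simp: not_le)
    then have "finite {i. \<alpha> i \<le> c}"
      unfolding cofinite_eq_sequentially[symmetric] by (simp add: eventually_cofinite)
    moreover have "{x. x \<le> c \<and> f x \<noteq> 0} \<subseteq> \<alpha> ` {i. \<alpha> i \<le> c}"
    proof
      fix x assume x: "x \<in> {x. x \<le> c \<and> f x \<noteq> 0}"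
      then obtain i where "x = \<alpha> i" using zero[of x] by fastforce
      then show "x \<in> \<alpha> ` {i. \<alpha> i \<le> c}" using x by simp
    qed
    ultimately show "finite {x. x \<le> c \<and> f x \<noteq> 0}" by (meson finite_imageI finite_subset)
  qed
qed

typedef series = "{f. left_finite f}"
  morphisms series_nth Abs_series
  by (rule exI[of _ "\<lambda>_. 0"]) (simp add: left_finite_def)

setup_lifting type_definition_series

lemma series_eqI: "(\<And>x. series_nth a x = series_nth b x) \<Longrightarrow> a = b"
  by (simp add: series_nth_inject[symmetric] fun_eq_iff)

lemma finite_series_nth: "finite {x. x \<le> c \<and> series_nth a x \<noteq> 0}"
  using series_nth[of a] by (simp add: left_finite_def)

lemma left_finite_bounded_below:
  assumes "left_finite f"
  obtains m where "\<And>x. f x \<noteq> 0 \<Longrightarrow> m \<le> x"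
proof -
  let ?F = "insert 0 {x. x \<le> 0 \<and> f x \<noteq> 0}"
  have fin: "finite ?F" using assms by (simp add: left_finite_def)
  have "Min ?F \<le> x" if "f x \<noteq> 0" for x
  proof (cases "x \<le> 0")
    case True
    then show ?thesis using that fin by (intro Min_le) auto
  next
    case False
    have "Min ?F \<le> 0" using fin by (intro Min_le) auto
    then show ?thesis using False by linarith
  qed
  then show thesis using that by blast
qed

lemma series_nth_bounded_below:
  obtains m where "\<And>x. series_nth a x \<noteq> 0 \<Longrightarrow> m \<le> x"
  using left_finite_bounded_below series_nth[of a] by blast

definition conv :: "(real \<Rightarrow> complex) \<Rightarrow> (real \<Rightarrow> complex) \<Rightarrow> real \<Rightarrow> complex" where
  "conv f g x = (\<Sum>y | f y \<noteq> 0 \<and> g (x - y) \<noteq> 0. f y * g (x - y))"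

lemma conv_superset:
  assumes "finite A" "\<And>y. f y \<noteq> 0 \<Longrightarrow> g (x - y) \<noteq> 0 \<Longrightarrow> y \<in> A"
  shows "conv f g x = (\<Sum>y\<in>A. f y * g (x - y))"
  unfolding conv_def using assms by (intro sum.mono_neutral_left) auto

lemma conv_commute: "conv f g x = conv g f x"
  unfolding conv_def
  by (rule sum.reindex_bij_witness[where i = "\<lambda>y. x - y" and j = "\<lambda>y. x - y"]) auto

lemma conv_nonzeroE:
  assumes "conv f g x \<noteq> 0"
  obtains y where "f y \<noteq> 0" "g (x - y) \<noteq> 0"
proof -
  have "\<exists>y. f y \<noteq> 0 \<and> g (x - y) \<noteq> 0"
  proof (rule ccontr)
    assume "\<not> ?thesis"
    then have "{y. f y \<noteq> 0 \<and> g (x - y) \<noteq> 0} = {}" by blast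
    then have "conv f g x = 0" by (simp only: conv_def sum.empty)
    then show False using assms by simp
  qed
  then show thesis using that by blast
qed

lemma left_finite_conv:
  assumes "left_finite f" "left_finite g"
  shows "left_finite (conv f g)"
proof -
  obtain m where m: "\<And>x. f x \<noteq> 0 \<Longrightarrow> m \<le> x" using left_finite_bounded_below assms(1) by blast
  obtain n where n: "\<And>x. g x \<noteq> 0 \<Longrightarrow> n \<le> x" using left_finite_bounded_below assms(2) by blast
  show ?thesis unfolding left_finite_def
  proof
    fix c
    let ?A = "{y. y \<le> c - n \<and> f y \<noteq> 0}" and ?B = "{z. z \<le> c - m \<and> g z \<noteq> 0}"
    have "{x. x \<le> c \<and> conv f g x \<noteq> 0} \<subseteq> (\<lambda>(y, z). y + z) ` (?A \<times> ?B)"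
    proof
      fix x assume "x \<in> {x. x \<le> c \<and> conv f g x \<noteq> 0}"
      then have x: "x \<le> c" and "conv f g x \<noteq> 0" by auto
      from this(2) obtain y where y: "f y \<noteq> 0" "g (x - y) \<noteq> 0"
        by (rule conv_nonzeroE)
      have "(y, x - y) \<in> ?A \<times> ?B" using y x m[OF y(1)] n[OF y(2)] by auto
      then show "x \<in> (\<lambda>(y, z). y + z) ` (?A \<times> ?B)" by (intro image_eqI) auto
    qed
    moreover have "finite (?A \<times> ?B)" using assms by (simp add: left_finite_def)
    ultimately show "finite {x. x \<le> c \<and> conv f g x \<noteq> 0}"
      by (meson finite_imageI finite_subset)
  qed
qed

instantiation series :: comm_ring_1
begin

lift_definition zero_series :: series is "\<lambda>_. 0"
  by (simp add: left_finite_def)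

lift_definition one_series :: series is "\<lambda>x. if x = 0 then 1 else 0"
  by (auto simp: left_finite_def intro: finite_subset[of _ "{0}"])

lift_definition plus_series :: "series \<Rightarrow> series \<Rightarrow> series" is "\<lambda>f g x. f x + g x"
  unfolding left_finite_def
proof
  fix f g :: "real \<Rightarrow> complex" and c
  assume "\<forall>c. finite {x. x \<le> c \<and> f x \<noteq> 0}" "\<forall>c. finite {x. x \<le> c \<and> g x \<noteq> 0}"
  then have "finite ({x. x \<le> c \<and> f x \<noteq> 0} \<union> {x. x \<le> c \<and> g x \<noteq> 0})" by simp
  then show "finite {x. x \<le> c \<and> f x + g x \<noteq> 0}" by (rule rev_finite_subset) auto
qed

lift_definition uminus_series :: "series \<Rightarrow> series" is "\<lambda>f x. - f x"
  by (simp add: left_finite_def)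

definition minus_series :: "series \<Rightarrow> series \<Rightarrow> series" where
  "minus_series a b = a + - b"

lift_definition times_series :: "series \<Rightarrow> series \<Rightarrow> series" is conv
  by (rule left_finite_conv)

lemma series_nth_mult_superset:
  assumes "finite A" "\<And>y. series_nth a y \<noteq> 0 \<Longrightarrow> series_nth b (x - y) \<noteq> 0 \<Longrightarrow> y \<in> A"
  shows "series_nth (a * b) x = (\<Sum>y\<in>A. series_nth a y * series_nth b (x - y))"
  using conv_superset[OF assms] by (simp add: times_series.rep_eq)

lemma mult_supp:
  assumes "series_nth (a * b) x \<noteq> 0" "\<And>x. series_nth a x \<noteq> 0 \<Longrightarrow> r \<le> x" "\<And>x. series_nth b x \<noteq> 0 \<Longrightarrow> s \<le> x"
  shows "r + s \<le> x"
proof -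
  obtain z where "series_nth a z \<noteq> 0" "series_nth b (x - z) \<noteq> 0"
    using assms(1) unfolding times_series.rep_eq by (rule conv_nonzeroE)
  then show ?thesis using assms(2)[of z] assms(3)[of "x - z"] by linarith
qed

lemma mult_commute_series: "a * b = b * (a :: series)"
  by (rule series_eqI) (simp add: times_series.rep_eq conv_commute)

lemma mult_assoc_series: "a * b * c = a * (b * (c :: series))"
proof (rule series_eqI)
  fix x
  obtain m where m: "\<And>x. series_nth a x \<noteq> 0 \<Longrightarrow> m \<le> x" using series_nth_bounded_below by blast
  obtain n where n: "\<And>x. series_nth b x \<noteq> 0 \<Longrightarrow> n \<le> x" using series_nth_bounded_below by blast
  obtain p where p: "\<And>x. series_nth c x \<noteq> 0 \<Longrightarrow> p \<le> x" using series_nth_bounded_below by blast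
  define A where "A = {y. y \<le> x - n - p \<and> series_nth a y \<noteq> 0}"
  define C where "C = {y. y \<le> x - m - n \<and> series_nth c y \<noteq> 0}"
  have fin: "finite A" "finite C" unfolding A_def C_def by (rule finite_series_nth)+
  have "series_nth (a * b * c) x = (\<Sum>z\<in>C. series_nth c z * series_nth (a * b) (x - z))"
    unfolding mult_commute_series[of "a * b" c]
  proof (rule series_nth_mult_superset[OF fin(2)])
    fix z assume z: "series_nth c z \<noteq> 0" "series_nth (a * b) (x - z) \<noteq> 0"
    have "m + n \<le> x - z" using z(2) m n by (rule mult_supp)
    then show "z \<in> C" using z(1) by (simp add: C_def)
  qed
  also have "\<dots> = (\<Sum>z\<in>C. series_nth c z * (\<Sum>y\<in>A. series_nth a y * series_nth b (x - z - y)))"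
  proof (intro sum.cong refl arg_cong2[where f = "(*)"] series_nth_mult_superset[OF fin(1)])
    fix z y assume "z \<in> C" "series_nth a y \<noteq> 0" "series_nth b (x - z - y) \<noteq> 0"
    then show "y \<in> A" using n[of "x - z - y"] p[of z] by (auto simp: A_def C_def)
  qed
  also have "\<dots> = (\<Sum>y\<in>A. series_nth a y * (\<Sum>z\<in>C. series_nth c z * series_nth b (x - y - z)))"
    unfolding sum_distrib_left
    by (subst sum.swap) (simp add: mult.left_commute diff_diff_add add.commute)
  also have "\<dots> = (\<Sum>y\<in>A. series_nth a y * series_nth (c * b) (x - y))"
  proof (intro sum.cong refl arg_cong2[where f = "(*)"] series_nth_mult_superset[OF fin(2), symmetric])
    fix z y assume "y \<in> A" "series_nth c z \<noteq> 0" "series_nth b (x - y - z) \<noteq> 0"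
    then show "z \<in> C" using n[of "x - y - z"] m[of y] by (auto simp: A_def C_def)
  qed
  also have "\<dots> = series_nth (a * (b * c)) x"
    unfolding mult_commute_series[of c b]
  proof (rule series_nth_mult_superset[OF fin(1), symmetric])
    fix y assume y: "series_nth a y \<noteq> 0" "series_nth (b * c) (x - y) \<noteq> 0"
    have "n + p \<le> x - y" using y(2) n p by (rule mult_supp)
    then show "y \<in> A" using y(1) by (simp add: A_def)
  qed
  finally show "series_nth (a * b * c) x = series_nth (a * (b * c)) x" .
qed

lemma distrib_series: "(a + b) * c = a * c + b * (c :: series)"
proof (rule series_eqI)
  fix x
  obtain p where p: "\<And>x. series_nth c x \<noteq> 0 \<Longrightarrow> p \<le> x" using series_nth_bounded_below by blast
  define A where "A = {y. y \<le> x - p \<and> series_nth a y \<noteq> 0} \<union> {y. y \<le> x - p \<and> series_nth b y \<noteq> 0}"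
  have fin: "finite A" unfolding A_def by (intro finite_UnI finite_series_nth)
  have "series_nth ((a + b) * c) x = (\<Sum>y\<in>A. series_nth (a + b) y * series_nth c (x - y))"
    "series_nth (a * c) x = (\<Sum>y\<in>A. series_nth a y * series_nth c (x - y))"
    "series_nth (b * c) x = (\<Sum>y\<in>A. series_nth b y * series_nth c (x - y))"
    by (rule series_nth_mult_superset[OF fin];
        (use p in \<open>force simp: A_def plus_series.rep_eq\<close>))+
  then show "series_nth ((a + b) * c) x = series_nth (a * c + b * c) x"
    by (simp add: plus_series.rep_eq distrib_right sum.distrib)
qed

instance
proof
  fix a b c :: series
  show "a + b + c = a + (b + c)" "a + b = b + a" "0 + a = a" "- a + a = 0"
    by (rule series_eqI,
        simp add: plus_series.rep_eq zero_series.rep_eq uminus_series.rep_eq add_ac)+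
  show "a - b = a + - b" by (rule minus_series_def)
  show "a * b * c = a * (b * c)" by (rule mult_assoc_series)
  show "a * b = b * a" by (rule mult_commute_series)
  show "(a + b) * c = a * c + b * c" by (rule distrib_series)
  show "1 * a = a"
  proof (rule series_eqI)
    fix x
    have "series_nth (1 * a) x = (\<Sum>y\<in>{0}. series_nth 1 y * series_nth a (x - y))"
      by (rule series_nth_mult_superset) (auto simp: one_series.rep_eq split: if_splits)
    then show "series_nth (1 * a) x = series_nth a x" by (simp add: one_series.rep_eq)
  qed
  have "series_nth 0 0 \<noteq> series_nth 1 0" by (simp add: zero_series.rep_eq one_series.rep_eq)
  then show "(0 :: series) \<noteq> 1" by metis
qed

end

lift_definition series_single :: "real \<Rightarrow> complex \<Rightarrow> series" is "\<lambda>d k x. if x = d then k else 0"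
  by (auto simp: left_finite_def intro: finite_subset[of _ "{d}" for d])

lemma series_nth_single_mult: "series_nth (series_single d k * a) x = k * series_nth a (x - d)"
proof -
  have "series_nth (series_single d k * a) x = (\<Sum>y\<in>{d}. series_nth (series_single d k) y * series_nth a (x - y))"
    by (rule series_nth_mult_superset) (auto simp: series_single.rep_eq split: if_splits)
  then show ?thesis by (simp add: series_single.rep_eq)
qed

lemma series_nth_diff: "series_nth (a - b) x = series_nth a x - series_nth b x"
  unfolding minus_series_def plus_series.rep_eq uminus_series.rep_eq by simp

lemma series_nth_sum: "series_nth (sum h A) x = (\<Sum>i\<in>A. series_nth (h i) x)"
  by (induction A rule: infinite_finite_induct)
     (simp_all add: zero_series.rep_eq plus_series.rep_eq)

lemma series_nth_least:
  assumes "a \<noteq> 0"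
  shows "\<exists>d. series_nth a d \<noteq> 0 \<and> (\<forall>x. series_nth a x \<noteq> 0 \<longrightarrow> d \<le> x)"
proof -
  have "\<exists>c. series_nth a c \<noteq> series_nth 0 c"
  proof (rule ccontr)
    assume "\<not> ?thesis"
    then have "a = 0" by (intro series_eqI) simp
    then show False using assms by contradiction
  qed
  then obtain c where c: "series_nth a c \<noteq> 0"
    by (auto simp: zero_series.rep_eq)
  let ?F = "{x. x \<le> c \<and> series_nth a x \<noteq> 0}"
  have fin: "finite ?F" by (rule finite_series_nth)
  have "Min ?F \<in> ?F" using fin c by (intro Min_in) auto
  then have "series_nth a (Min ?F) \<noteq> 0" by blast
  moreover have "Min ?F \<le> x" if "series_nth a x \<noteq> 0" for x
  proof (cases "x \<le> c")
    case True
    then show ?thesis using fin that by (intro Min_le) auto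
  next
    case False
    have "Min ?F \<le> c" using fin c by (intro Min_le) auto
    then show ?thesis using False by linarith
  qed
  ultimately show ?thesis by blast
qed

lemma geometric_inverse:
  assumes \<delta>: "\<delta> > 0" and u: "\<And>x. series_nth u x \<noteq> 0 \<Longrightarrow> \<delta> \<le> x"
  shows "\<exists>g. (1 - u) * g = 1"
proof -
  have pow: "real n * \<delta> \<le> x" if "series_nth (u ^ n) x \<noteq> 0" for n x
    using that
  proof (induction n arbitrary: x)
    case 0
    then show ?case by (simp add: one_series.rep_eq split: if_splits)
  next
    case (Suc n)
    have "series_nth (u * u ^ n) x \<noteq> 0" using Suc.prems by simp
    then have "\<delta> + real n * \<delta> \<le> x" using u Suc.IH by (rule mult_supp)
    then show ?case by (simp add: algebra_simps)
  qed
  define N where "N x = nat \<lceil>x / \<delta>\<rceil>" for x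
  define G where "G N = (\<Sum>n\<le>N. u ^ n)" for N
  define f where "f x = series_nth (G (N x)) x" for x
  have N: "x \<le> real (N x) * \<delta>" for x
  proof -
    have "x / \<delta> \<le> real (N x)" unfolding N_def by linarith
    then show ?thesis using \<delta> by (simp add: field_simps)
  qed
  have G: "series_nth (G K) x = f x" if "x \<le> c" "N c \<le> K" for K x c
  proof -
    have NK: "N x \<le> K"
    proof -
      have "x / \<delta> \<le> c / \<delta>" using that \<delta> by (simp add: divide_right_mono)
      then have "N x \<le> N c" unfolding N_def by (intro nat_mono ceiling_mono)
      then show ?thesis using that by simp
    qed
    have "(\<Sum>n\<le>K. series_nth (u ^ n) x) = (\<Sum>n\<le>N x. series_nth (u ^ n) x)"
    proof (rule sum.mono_neutral_right)
      show "\<forall>n\<in>{..K} - {..N x}. series_nth (u ^ n) x = 0"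
      proof
        fix n assume "n \<in> {..K} - {..N x}"
        then have "real (N x) < real n" by simp
        then have "real (N x) * \<delta> < real n * \<delta>" using \<delta> by simp
        then show "series_nth (u ^ n) x = 0" using N[of x] pow[of n x] by linarith
      qed
    qed (use NK in auto)
    then show ?thesis by (simp add: f_def G_def series_nth_sum)
  qed
  have "left_finite f"
    unfolding left_finite_def
  proof
    fix c
    have "{x. x \<le> c \<and> f x \<noteq> 0} = {x. x \<le> c \<and> series_nth (G (N c)) x \<noteq> 0}" using G by auto
    then show "finite {x. x \<le> c \<and> f x \<noteq> 0}" using finite_series_nth by simp
  qed
  then have f: "series_nth (Abs_series f) = f" by (simp add: Abs_series_inverse)
  have "(1 - u) * Abs_series f = 1"
  proof (rule series_eqI)
    fix x
    define K where "K = N x"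
    let ?A = "{y. y \<le> x \<and> f y \<noteq> 0}"
    have pos: "0 \<le> y" if "series_nth (1 - u) y \<noteq> 0" for y
      using that u[of y] \<delta> by (auto simp: series_nth_diff one_series.rep_eq split: if_splits)
    have fin: "finite ?A" using \<open>left_finite f\<close> by (simp add: left_finite_def)
    have "series_nth (Abs_series f * (1 - u)) x =
        (\<Sum>y\<in>?A. series_nth (Abs_series f) y * series_nth (1 - u) (x - y))"
    proof (rule series_nth_mult_superset[OF fin])
      fix y assume "series_nth (Abs_series f) y \<noteq> 0" "series_nth (1 - u) (x - y) \<noteq> 0"
      then show "y \<in> ?A" using pos[of "x - y"] by (simp add: f)
    qed
    then have "series_nth ((1 - u) * Abs_series f) x = (\<Sum>y\<in>?A. f y * series_nth (1 - u) (x - y))"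
      by (simp only: f mult.commute[of "1 - u"])
    also have "\<dots> = (\<Sum>y\<in>?A. series_nth (G K) y * series_nth (1 - u) (x - y))"
      by (intro sum.cong refl) (use G in \<open>auto simp: K_def\<close>)
    also have "\<dots> = series_nth (G K * (1 - u)) x"
    proof (rule series_nth_mult_superset[symmetric, OF fin])
      fix y assume y: "series_nth (G K) y \<noteq> 0" "series_nth (1 - u) (x - y) \<noteq> 0"
      then have "y \<le> x" using pos[of "x - y"] by simp
      then show "y \<in> ?A" using y G[of y x K] by (simp add: K_def)
    qed
    also have "G K * (1 - u) = 1 - u ^ Suc K"
      unfolding G_def using sum_gp_basic[of u K] by (simp add: mult.commute)
    also have "series_nth (1 - u ^ Suc K) x = series_nth 1 x"
    proof -
      have "real K * \<delta> < real (Suc K) * \<delta>" using \<delta> by simp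
      then have "series_nth (u ^ Suc K) x = 0" using pow[of "Suc K" x] N[of x] unfolding K_def by linarith
      then show ?thesis by (simp only: series_nth_diff diff_0_right)
    qed
    finally show "series_nth ((1 - u) * Abs_series f) x = series_nth 1 x" .
  qed
  then show ?thesis by blast
qed

lemma series_inverse_exists:
  fixes a :: series
  assumes "a \<noteq> 0"
  shows "\<exists>b. a * b = 1"
proof -
  obtain d where d: "series_nth a d \<noteq> 0" "\<And>x. series_nth a x \<noteq> 0 \<Longrightarrow> d \<le> x"
    using series_nth_least[OF assms] by blast
  define s where "s = series_single (- d) (1 / series_nth a d)"
  define u where "u = 1 - s * a"
  have cu: "series_nth u x = (if x = 0 then 0 else - series_nth a (x + d) / series_nth a d)" for x
    using d(1) by (simp add: u_def s_def series_nth_diff series_nth_single_mult one_series.rep_eq)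
  have "\<exists>\<delta>>0. \<forall>x. series_nth u x \<noteq> 0 \<longrightarrow> \<delta> \<le> x"
  proof (cases "u = 0")
    case True
    then show ?thesis by (intro exI[of _ 1]) (simp add: zero_series.rep_eq)
  next
    case False
    obtain \<delta> where \<delta>: "series_nth u \<delta> \<noteq> 0" "\<And>x. series_nth u x \<noteq> 0 \<Longrightarrow> \<delta> \<le> x"
      using series_nth_least[OF False] by blast
    have "\<delta> \<noteq> 0" "series_nth a (\<delta> + d) \<noteq> 0" using \<delta>(1) by (auto simp: cu split: if_splits)
    then have "\<delta> > 0" using d(2)[of "\<delta> + d"] by linarith
    then show ?thesis using \<delta>(2) by blast
  qed
  then obtain \<delta> where "\<delta> > 0" "\<And>x. series_nth u x \<noteq> 0 \<Longrightarrow> \<delta> \<le> x" by blast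
  then have "\<exists>g. (1 - u) * g = 1" by (rule geometric_inverse)
  then obtain g where "(1 - u) * g = 1" ..
  then have "a * (s * g) = 1" by (simp add: u_def mult_ac)
  then show ?thesis by blast
qed

instantiation series :: field
begin

definition inverse_series :: "series \<Rightarrow> series" where
  "inverse_series a = (if a = 0 then 0 else SOME b. a * b = 1)"

definition divide_series :: "series \<Rightarrow> series \<Rightarrow> series" where
  "divide_series a b = a * inverse b"

instance
proof
  fix a b :: series
  show "inverse a * a = 1" if "a \<noteq> 0"
    using someI_ex[OF series_inverse_exists[OF that]] that
    by (simp add: inverse_series_def mult.commute)
  show "a div b = a * inverse b" by (rule divide_series_def)
  show "inverse (0 :: series) = 0" by (simp add: inverse_series_def)
qed

end

subsection \<open>Kapranov rank\<close>

definition series_deg :: "series \<Rightarrow> ereal" where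
  "series_deg a = (if a = 0 then \<infinity> else ereal (LEAST x. series_nth a x \<noteq> 0))"

definition is_lift :: "series mat \<Rightarrow> real mat \<Rightarrow> bool" where
  "is_lift B T \<longleftrightarrow> dim_row B = dim_row T \<and> dim_col B = dim_col T \<and>
     (\<forall>i<dim_row T. \<forall>j<dim_col T. series_deg (B $$ (i, j)) = ereal (T $$ (i, j)))"

definition kapranov_rank :: "real mat \<Rightarrow> nat" where
  "kapranov_rank M = (LEAST r. \<exists>B. is_lift B M \<and> vec_space.rank (dim_row B) B = r)"

end

theory Submission
  imports Defs
begin

text \<open>The rows and columns of the matrix \<open>A\<close> fall into three blocks \<open>{0, 1}\<close>, \<open>{2, 3}\<close>,
\<open>{4, 5}\<close>. All entries are nonnegative, and an entry is zero exactly when its row and its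
column lie in the same block. The off-diagonal block with rows from block
\<open>a\<close> and columns from block \<open>b\<close> contains a single entry below \<open>4\<close>, in the odd row
\<open>2a + 1\<close> and the even column \<open>2b\<close>; the other three are \<open>4\<close>. The small entries are \<open>2, 1, 2, 2, 2, 1\<close> for the pairs
\<open>(0,1), (0,2), (1,0), (1,2), (2,0), (2,1)\<close>.

Tropical rank. These six numbers satisfy the triangle inequality. Hence, after deletion of a row of
block \<open>a\<close> and a column of block \<open>b\<close>, an optimal assignment uses the direct step from block \<open>b\<close>
to block \<open>a\<close> and zero entries elsewhere; the block potential given by the distance to \<open>a\<close> is a dual
certificate (\<open>block_dist_potential\<close>). Then some block \<open>c\<close> other than \<open>a\<close>, \<open>b\<close> survives undamaged as a
2-by-2 block of zeros, and exchanging its two columns gives a second optimal assignment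
(\<open>trop_singular_swap\<close>). So all 5-by-5 submatrices are singular, as is \<open>A\<close>; the rows
\<open>0, 2, 4, 5\<close> and columns \<open>0, 1, 2, 4\<close> give a nonsingular submatrix.

Kapranov rank. Suppose that a lift \<open>B\<close> has rank at most four. Eliminating the unit pivots
\<open>(0,0)\<close>, \<open>(2,2)\<close>, \<open>(4,4)\<close> would leave a 3-by-3 matrix \<open>S\<close> of rank at most one. The pivoting
changes an off-diagonal block only by terms of degree at least \<open>4\<close>, apart from moving its small entry from the
even to the odd column, so the degrees of the off-diagonal entries of \<open>S\<close> are the six numbers
above. A matrix of rank one satisfies \<open>s01 * s12 * s20 = s02 * s21 * s10\<close>, but here the two sides have degrees
\<open>2 + 2 + 2\<close> and \<open>1 + 1 + 2\<close>. The formal proof states the same obstruction for kernel vectors, which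
avoids the Schur complement: a kernel vector that vanishes in the odd column of one block
has its other two odd coordinates in a prescribed ratio of degrees (\<open>kernel_deg_quotient\<close>). Two vanishing
5-by-5 minors provide two such vectors, and a combination of them is of the same kind for
the third block but has the wrong ratio (\<open>rank_lift_A6_ge_5\<close>). Conversely, every column of \<open>A\<close> attains its
minimum twice, so one can choose a lift whose rows add up to zero; it has rank at most five
(\<open>singular_lift_A6\<close>).\<close>

section \<open>Submatrices\<close>

lemma bij_betw_pick:
  assumes "finite I"
  shows "bij_betw (pick I) {..<card I} I"
  unfolding bij_betw_def
proof
  show inj: "inj_on (pick I) {..<card I}"
    by (intro strict_mono_on_imp_inj_on strict_mono_onI) (simp add: pick_mono_le)
  show "pick I ` {..<card I} = I"
  proof (rule card_subset_eq[OF assms])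
    show "pick I ` {..<card I} \<subseteq> I" by (auto intro: pick_in_set_le)
    show "card (pick I ` {..<card I}) = card I" using card_image[OF inj] by simp
  qed
qed

text \<open>A square submatrix larger than the rank has determinant zero, hence a kernel vector; it is returned as a function on
the original column indices, so that vectors from different submatrices can be combined.\<close>
lemma zero_rank_submatrix:
  fixes B :: "'a::field mat"
  assumes B: "B \<in> carrier_mat n nc" and I: "I \<subseteq> {..<n}" and J: "J \<subseteq> {..<nc}"
    and card: "card I = card J" and rank: "vec_space.rank n B < card J"
  obtains x where "\<And>i. i \<in> I \<Longrightarrow> (\<Sum>j\<in>J. B $$ (i, j) * x j) = 0" "\<exists>j\<in>J. x j \<noteq> 0"
proof -
  define S where "S = submatrix B I J"
  define r where "r = card J"
  have finI: "finite I" and finJ: "finite J" by (rule finite_subset[OF I], simp, rule finite_subset[OF J], simp)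
  have sets: "{i. i < n \<and> i \<in> I} = I" "{j. j < nc \<and> j \<in> J} = J"
    by (use I in blast, use J in blast)
  have S: "S \<in> carrier_mat r r"
    by (rule carrier_matI) (use B sets card in \<open>simp_all add: S_def r_def dim_submatrix\<close>)
  have "det S = 0"
  proof (rule ccontr)
    assume "det S \<noteq> 0"
    then have "card {j. j < nc \<and> j \<in> J} \<le> vec_space.rank n B"
      unfolding S_def by (rule vec_space.rank_gt_minor[OF B])
    then show False using rank sets(2) by simp
  qed
  then obtain v where v: "v \<in> carrier_vec r" "v \<noteq> 0\<^sub>v r" "S *\<^sub>v v = 0\<^sub>v r"
    using det_0_iff_vec_prod_zero[OF S] by blast
  note bI = bij_betw_pick[OF finI] and bJ = bij_betw_pick[OF finJ]
  define x where "x j = v $ the_inv_into {..<r} (pick J) j" for j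
  have x: "x (pick J k) = v $ k" if "k < r" for k
    using bJ that unfolding x_def r_def by (simp add: the_inv_into_f_f bij_betw_def)
  show thesis
  proof
    fix i assume "i \<in> I"
    then obtain a where a: "a < r" "i = pick I a"
      using bI card unfolding bij_betw_def r_def by auto
    have "(\<Sum>j\<in>J. B $$ (i, j) * x j) = (\<Sum>k<r. B $$ (i, pick J k) * x (pick J k))"
      using sum.reindex_bij_betw[OF bJ, of "\<lambda>j. B $$ (i, j) * x j"] by (simp add: r_def)
    also have "\<dots> = (\<Sum>k<r. S $$ (a, k) * v $ k)"
      using a B sets card by (intro sum.cong refl) (simp add: x S_def submatrix_index r_def)
    also have "\<dots> = (S *\<^sub>v v) $ a"
      using S v(1) a by (auto simp: scalar_prod_def lessThan_atLeast0 intro!: sum.cong)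
    finally show "(\<Sum>j\<in>J. B $$ (i, j) * x j) = 0" using v(3) a by simp
  next
    obtain k where k: "k < r" "v $ k \<noteq> 0" using v(1,2) by (metis carrier_vecD eq_vecI index_zero_vec)
    then show "\<exists>j\<in>J. x j \<noteq> 0" using x[of k] bJ unfolding bij_betw_def r_def by (intro bexI[of _ "pick J k"]) auto
  qed
qed

section \<open>Degrees of series\<close>

text \<open>The inequality \<open>ereal c \<le> series_deg a\<close>, in a form that covers \<open>a = 0\<close> without infinite degrees.\<close>
definition le_deg :: "real \<Rightarrow> series \<Rightarrow> bool" where
  "le_deg c a \<longleftrightarrow> (\<forall>x<c. series_nth a x = 0)"

lemma series_deg_eq_iff:
  "series_deg a = ereal r \<longleftrightarrow> series_nth a r \<noteq> 0 \<and> le_deg r a"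
proof (cases "a = 0")
  case True
  then show ?thesis by (simp add: series_deg_def zero_series.rep_eq)
next
  case False
  obtain d where d: "series_nth a d \<noteq> 0" "\<And>x. series_nth a x \<noteq> 0 \<Longrightarrow> d \<le> x"
    using series_nth_least[OF False] by blast
  have "(LEAST x. series_nth a x \<noteq> 0) = d"
    by (rule Least_equality) (use d in auto)
  then have "series_deg a = ereal d" using False by (simp add: series_deg_def)
  moreover have "r = d \<longleftrightarrow> series_nth a r \<noteq> 0 \<and> le_deg r a"
    using d unfolding le_deg_def by (metis less_eq_real_def linorder_not_le)
  ultimately show ?thesis by auto
qed

lemma series_deg_finite:
  assumes "a \<noteq> 0"
  obtains r where "series_deg a = ereal r"
  using assms by (auto simp: series_deg_def)

lemma le_deg_zero [simp]: "le_deg c 0"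
  by (simp add: le_deg_def zero_series.rep_eq)

lemma le_deg_mono: "le_deg c a \<Longrightarrow> d \<le> c \<Longrightarrow> le_deg d a"
  by (auto simp: le_deg_def)

lemma le_deg_add: "le_deg c a \<Longrightarrow> le_deg c b \<Longrightarrow> le_deg c (a + b)"
  by (simp add: le_deg_def plus_series.rep_eq)

lemma le_deg_uminus [simp]: "le_deg c (- a) \<longleftrightarrow> le_deg c a"
  by (simp add: le_deg_def uminus_series.rep_eq)

lemma le_deg_mult:
  assumes "le_deg c a" "le_deg d b"
  shows "le_deg (c + d) (a * b)"
  unfolding le_deg_def
proof (intro allI impI)
  fix x assume "x < c + d"
  then show "series_nth (a * b) x = 0"
    using mult_supp[of a b x c d] assms unfolding le_deg_def by (meson linorder_not_le)
qed

lemma series_deg_uminus [simp]: "series_deg (- a) = series_deg a"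
  by (simp add: series_deg_def uminus_series.rep_eq)

lemma series_deg_mult:
  assumes "series_deg a = ereal r" "series_deg b = ereal s"
  shows "series_deg (a * b) = ereal (r + s)"
proof -
  have a: "series_nth a r \<noteq> 0" "le_deg r a" and b: "series_nth b s \<noteq> 0" "le_deg s b"
    using assms by (simp_all add: series_deg_eq_iff)
  have "series_nth (a * b) (r + s) = (\<Sum>y\<in>{r}. series_nth a y * series_nth b (r + s - y))"
  proof (rule series_nth_mult_superset)
    fix y assume "series_nth a y \<noteq> 0" "series_nth b (r + s - y) \<noteq> 0"
    then have "r \<le> y" "s \<le> r + s - y" using a(2) b(2) unfolding le_deg_def by (meson linorder_not_le)+
    then show "y \<in> {r}" by simp
  qed simp
  then have "series_nth (a * b) (r + s) \<noteq> 0" using a(1) b(1) by simp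
  then show ?thesis using le_deg_mult[OF a(2) b(2)] by (simp add: series_deg_eq_iff)
qed

lemma series_deg_cong:
  assumes "series_deg a = ereal r" "le_deg c (a + b)" "r < c"
  shows "series_deg b = ereal r"
proof -
  have "series_nth b x = - series_nth a x" if "x < c" for x
    using assms(2) that by (simp add: le_deg_def plus_series.rep_eq add_eq_0_iff)
  then show ?thesis using assms(1,3) by (simp add: series_deg_eq_iff le_deg_def)
qed

lemma series_deg_mult_cancel:
  assumes "series_deg a = ereal r" "series_deg (a * b) = ereal s"
  shows "series_deg b = ereal (s - r)"
proof -
  have "b \<noteq> 0" using assms(2) by (auto simp: series_deg_def)
  then obtain d where d: "series_deg b = ereal d" by (rule series_deg_finite)
  show ?thesis using series_deg_mult[OF assms(1) d] assms(2) d by simp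
qed

text \<open>If the sum of two terms has larger degree than the first term, their leading terms cancel, so that
the degree of one unknown determines that of the other.\<close>
lemma series_deg_balance:
  assumes "series_deg a = ereal \<alpha>" "series_deg b = ereal \<beta>" "series_deg x = ereal m"
    and "le_deg c (a * x + b * y)" "\<alpha> + m < c"
  shows "series_deg y = ereal (\<alpha> + m - \<beta>)"
  using series_deg_mult_cancel[OF assms(2)] series_deg_cong[OF series_deg_mult[OF assms(1,3)]] assms(4,5)
  by blast

lemma le_deg_series_deg: "series_deg a = ereal r \<Longrightarrow> le_deg r a"
  by (simp add: series_deg_eq_iff)

lemma le_deg_mult_cancel:
  assumes "series_deg a = ereal r" "le_deg (r + c) (a * b)"
  shows "le_deg c b"
proof (cases "b = 0")
  case False
  then obtain d where d: "series_deg b = ereal d" by (rule series_deg_finite)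
  have "series_deg (a * b) = ereal (r + d)" by (rule series_deg_mult[OF assms(1) d])
  then have "series_nth (a * b) (r + d) \<noteq> 0" by (simp add: series_deg_eq_iff)
  then have "c \<le> d" using assms(2) by (force simp: le_deg_def)
  then show ?thesis using le_deg_series_deg[OF d] le_deg_mono by blast
qed simp

section \<open>Tropical singularity of submatrices\<close>

definition optimal_bij :: "real mat \<Rightarrow> nat set \<Rightarrow> nat set \<Rightarrow> (nat \<Rightarrow> nat) \<Rightarrow> bool" where
  "optimal_bij M I J f \<longleftrightarrow> bij_betw f I J \<and>
     (\<forall>h. bij_betw h I J \<longrightarrow> (\<Sum>i\<in>I. M $$ (i, f i)) \<le> (\<Sum>i\<in>I. M $$ (i, h i)))"

text \<open>The function \<open>pick\<close> enumerates \<open>I\<close> and \<open>J\<close>, so permutations of the positions correspond to bijections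
from \<open>I\<close> to \<open>J\<close>, with equal weights. Later arguments never have to renumber rows or columns.\<close>
lemma trop_singular_submatrix_iff:
  assumes I: "I \<subseteq> {..<dim_row M}" and J: "J \<subseteq> {..<dim_col M}" and card: "card I = card J"
  shows "trop_singular (submatrix M I J) \<longleftrightarrow>
    (\<exists>f g. optimal_bij M I J f \<and> optimal_bij M I J g \<and> (\<exists>i\<in>I. f i \<noteq> g i))"
proof -
  define S where "S = submatrix M I J"
  define n where "n = card I"
  define W where "W f = (\<Sum>i\<in>I. M $$ (i, f i))" for f
  \<comment> \<open>\<open>R \<sigma> f\<close>: the permutation \<open>\<sigma>\<close> of positions is the bijection \<open>f\<close> of indices read through \<open>pick\<close>.\<close>
  define R where "R \<sigma> f \<longleftrightarrow> (\<forall>k<n. pick J (\<sigma> k) = f (pick I k))" for \<sigma> f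
  have finI: "finite I" by (rule finite_subset[OF I]) simp
  have finJ: "finite J" by (rule finite_subset[OF J]) simp
  have bI: "bij_betw (pick I) {..<n} I" unfolding n_def by (rule bij_betw_pick[OF finI])
  have bJ: "bij_betw (pick J) {..<n} J" unfolding n_def card by (rule bij_betw_pick[OF finJ])
  have sets: "{i. i < dim_row M \<and> i \<in> I} = I" "{j. j < dim_col M \<and> j \<in> J} = J"
    by (use I in blast, use J in blast)
  have dim: "dim_row S = n" by (simp add: S_def n_def dim_submatrix sets)
  have to_bij: "\<exists>f. bij_betw f I J \<and> R \<sigma> f" if \<sigma>: "\<sigma> permutes {..<n}" for \<sigma>
  proof (intro exI conjI)
    let ?f = "pick J \<circ> \<sigma> \<circ> the_inv_into {..<n} (pick I)"
    show "bij_betw ?f I J"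
      by (intro bij_betw_trans[OF bij_betw_the_inv_into[OF bI]] bij_betw_trans[OF permutes_imp_bij[OF \<sigma>] bJ])
    show "R \<sigma> ?f" unfolding R_def
      using bI by (auto simp: the_inv_into_f_f bij_betw_def)
  qed
  have to_perm: "\<exists>\<sigma>. \<sigma> permutes {..<n} \<and> R \<sigma> f" if f: "bij_betw f I J" for f
  proof -
    let ?g = "the_inv_into {..<n} (pick J) \<circ> (f \<circ> pick I)"
    let ?\<sigma> = "\<lambda>k. if k \<in> {..<n} then ?g k else k"
    have g: "bij_betw ?g {..<n} {..<n}"
      by (intro bij_betw_trans[OF bij_betw_trans[OF bI f]] bij_betw_the_inv_into[OF bJ])
    have "bij_betw ?\<sigma> {..<n} {..<n}"
      using g by (rule bij_betw_cong[THEN iffD1, rotated]) simp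
    then have "?\<sigma> permutes {..<n}" by (rule bij_imp_permutes) simp
    moreover have "R ?\<sigma> f" unfolding R_def
    proof (intro allI impI)
      fix k assume k: "k < n"
      then have "f (pick I k) \<in> pick J ` {..<n}"
        using bI bJ f by (auto simp: bij_betw_def)
      then show "pick J (?\<sigma> k) = f (pick I k)"
        using k bJ by (simp add: f_the_inv_into_f bij_betw_def)
    qed
    ultimately show ?thesis by blast
  qed
  have weight: "perm_weight S \<sigma> = W f" if "\<sigma> permutes {..<n}" "R \<sigma> f" for \<sigma> f
  proof -
    have "S $$ (k, \<sigma> k) = M $$ (pick I k, f (pick I k))" if k: "k < n" for k
    proof -
      have "\<sigma> k < n" using \<open>\<sigma> permutes {..<n}\<close> k by (simp add: permutes_in_image[of _ "{..<n}", simplified])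
      then have "S $$ (k, \<sigma> k) = M $$ (pick I k, pick J (\<sigma> k))"
        unfolding S_def using k card by (intro submatrix_index) (simp_all add: sets n_def)
      then show ?thesis using \<open>R \<sigma> f\<close> k by (simp add: R_def)
    qed
    then show ?thesis
      unfolding perm_weight_def W_def dim
      using sum.reindex_bij_betw[OF bI, of "\<lambda>i. M $$ (i, f i)"] by simp
  qed
  have opt: "perm_weight S \<sigma> = trop_perm S \<longleftrightarrow> optimal_bij M I J f"
    if \<sigma>: "\<sigma> permutes {..<n}" and f: "bij_betw f I J" and R: "R \<sigma> f" for \<sigma> f
  proof -
    have "perm_weight S \<sigma> = trop_perm S \<longleftrightarrow> (\<forall>\<tau>. \<tau> permutes {..<n} \<longrightarrow> perm_weight S \<sigma> \<le> perm_weight S \<tau>)"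
      unfolding trop_perm_def dim using \<sigma> 
      by (subst eq_commute, subst Min_eq_iff) (auto simp: finite_permutations)
    also have "\<dots> \<longleftrightarrow> (\<forall>h. bij_betw h I J \<longrightarrow> W f \<le> W h)"
      using weight \<sigma> R to_bij to_perm by metis
    finally show ?thesis using f by (simp add: optimal_bij_def W_def)
  qed
  have same: "\<sigma> = \<tau> \<longleftrightarrow> (\<forall>i\<in>I. f i = g i)"
    if \<sigma>: "\<sigma> permutes {..<n}" and \<tau>: "\<tau> permutes {..<n}" and R: "R \<sigma> f" "R \<tau> g" for \<sigma> \<tau> f g
  proof -
    have "\<sigma> = \<tau> \<longleftrightarrow> (\<forall>k<n. \<sigma> k = \<tau> k)"
      using \<sigma> \<tau> by (metis ext lessThan_iff permutes_not_in)
    also have "\<dots> \<longleftrightarrow> (\<forall>k<n. pick J (\<sigma> k) = pick J (\<tau> k))"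
    proof -
      have "pick J (\<sigma> k) = pick J (\<tau> k) \<longleftrightarrow> \<sigma> k = \<tau> k" if "k < n" for k
        using inj_on_eq_iff[of "pick J" "{..<n}"] bJ that permutes_in_image[OF \<sigma>, of k] permutes_in_image[OF \<tau>, of k]
        by (simp add: bij_betw_def)
      then show ?thesis by simp
    qed
    also have "\<dots> \<longleftrightarrow> (\<forall>k<n. f (pick I k) = g (pick I k))" using R by (simp add: R_def)
    also have "\<dots> \<longleftrightarrow> (\<forall>i\<in>I. f i = g i)"
    proof -
      have "(\<forall>i\<in>I. f i = g i) \<longleftrightarrow> (\<forall>i\<in>pick I ` {..<n}. f i = g i)"
        using bI by (simp add: bij_betw_def)
      then show ?thesis by auto
    qed
    finally show ?thesis .
  qed
  show ?thesis
  proof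
    assume "trop_singular (submatrix M I J)"
    then obtain \<sigma> \<tau> where st: "\<sigma> permutes {..<n}" "\<tau> permutes {..<n}" "\<sigma> \<noteq> \<tau>"
      "perm_weight S \<sigma> = trop_perm S" "perm_weight S \<tau> = trop_perm S"
      unfolding trop_singular_def S_def[symmetric] dim by blast
    obtain f g where fg: "bij_betw f I J" "R \<sigma> f" "bij_betw g I J" "R \<tau> g"
      using to_bij st(1,2) by metis
    show "\<exists>f g. optimal_bij M I J f \<and> optimal_bij M I J g \<and> (\<exists>i\<in>I. f i \<noteq> g i)"
      using opt[OF st(1) fg(1,2)] opt[OF st(2) fg(3,4)] same[OF st(1,2) fg(2,4)] st(3-5) by blast
  next
    assume "\<exists>f g. optimal_bij M I J f \<and> optimal_bij M I J g \<and> (\<exists>i\<in>I. f i \<noteq> g i)"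
    then obtain f g where fg: "optimal_bij M I J f" "optimal_bij M I J g" "\<exists>i\<in>I. f i \<noteq> g i" by blast
    have bij: "bij_betw f I J" "bij_betw g I J" using fg(1,2) by (simp_all add: optimal_bij_def)
    obtain \<sigma> \<tau> where st: "\<sigma> permutes {..<n}" "R \<sigma> f" "\<tau> permutes {..<n}" "R \<tau> g"
      using to_perm bij by metis
    show "trop_singular (submatrix M I J)"
      unfolding trop_singular_def S_def[symmetric] dim
      using opt[OF st(1) bij(1) st(2)] opt[OF st(3) bij(2) st(4)] same[OF st(1,3,2,4)] fg st(1,3) by blast
  qed
qed

text \<open>Exchanging the images of \<open>k\<close> and \<open>l\<close> produces a second optimal assignment.\<close>
lemma trop_singular_swap:
  assumes I: "I \<subseteq> {..<dim_row M}" and J: "J \<subseteq> {..<dim_col M}"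
    and f: "optimal_bij M I J f" and k: "k \<in> I" "l \<in> I" "k \<noteq> l"
    and swap: "M $$ (k, f k) + M $$ (l, f l) = M $$ (k, f l) + M $$ (l, f k)"
  shows "trop_singular (submatrix M I J)"
proof -
  let ?g = "f \<circ> transpose k l"
  have bij: "bij_betw f I J" using f by (simp add: optimal_bij_def)
  have fin: "finite I" by (rule finite_subset[OF I]) simp
  have "bij_betw ?g I J"
    using bij k by (intro bij_betw_trans[OF _ bij] permutes_imp_bij permutes_swap_id)
  moreover have "(\<Sum>i\<in>I. M $$ (i, ?g i)) = (\<Sum>i\<in>I. M $$ (i, f i))"
  proof -
    have split: "(\<Sum>i\<in>I. h i) = h k + h l + (\<Sum>i\<in>I - {k, l}. h i)" for h :: "nat \<Rightarrow> real"
      using k fin sum.remove[of I k h] sum.remove[of "I - {k}" l h] by (simp add: insert_commute Diff_insert2[symmetric])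
    have "(\<Sum>i\<in>I - {k, l}. M $$ (i, ?g i)) = (\<Sum>i\<in>I - {k, l}. M $$ (i, f i))"
      by (intro sum.cong) (auto simp: transpose_apply_other)
    then show ?thesis using swap by (subst (1 2) split) simp
  qed
  ultimately have "optimal_bij M I J ?g" using f by (simp add: optimal_bij_def)
  moreover have "f k \<noteq> ?g k" using bij k by (auto simp: bij_betw_def inj_on_def)
  ultimately show ?thesis
    using f k(1) bij_betw_same_card[OF bij] trop_singular_submatrix_iff[OF I J] by blast
qed

text \<open>Weak duality for the assignment problem, for row potential \<open>p\<close> and column potential \<open>- p\<close>.\<close>
lemma bij_betw_sum_potential:
  fixes p :: "nat \<Rightarrow> real"
  assumes "bij_betw h I J" "\<And>k. k \<in> I \<Longrightarrow> p k - p (h k) \<le> M $$ (k, h k)"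
  shows "(\<Sum>k\<in>I. p k) - (\<Sum>k\<in>J. p k) \<le> (\<Sum>k\<in>I. M $$ (k, h k))"
proof -
  have "(\<Sum>k\<in>J. p k) = (\<Sum>k\<in>I. p (h k))"
    using sum.reindex_bij_betw[OF assms(1), of p] by simp
  then have "(\<Sum>k\<in>I. p k) - (\<Sum>k\<in>J. p k) = (\<Sum>k\<in>I. p k - p (h k))" by (simp add: sum_subtractf)
  also have "\<dots> \<le> (\<Sum>k\<in>I. M $$ (k, h k))" by (intro sum_mono assms(2))
  finally show ?thesis .
qed

section \<open>The matrix\<close>

definition A6 :: "real mat" where
  "A6 = mat_of_rows_list 6
    [[0, 0, 4, 4, 4, 4],
     [0, 0, 2, 4, 1, 4],
     [4, 4, 0, 0, 4, 4],
     [2, 4, 0, 0, 2, 4],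
     [4, 4, 4, 4, 0, 0],
     [2, 4, 1, 4, 0, 0]]"

lemma dim_A6 [simp]: "dim_row A6 = 6" "dim_col A6 = 6"
  by (simp_all add: A6_def mat_of_rows_list_def)

lemma A6_index [simp]:
  assumes "i < 6" "j < 6"
  shows "A6 $$ (i, j) =
    [[0, 0, 4, 4, 4, 4],
     [0, 0, 2, 4, 1, 4],
     [4, 4, 0, 0, 4, 4],
     [2, 4, 0, 0, 2, 4],
     [4, 4, 4, 4, 0, 0],
     [2, 4, 1, 4, 0, 0]] ! i ! j"
  using assms by (simp add: A6_def mat_of_rows_list_def)

lemma A6_nonneg: "k < 6 \<Longrightarrow> l < 6 \<Longrightarrow> 0 \<le> A6 $$ (k, l)"
  and A6_eq_0_iff: "k < 6 \<Longrightarrow> l < 6 \<Longrightarrow> A6 $$ (k, l) = 0 \<longleftrightarrow> k div 2 = l div 2"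
proof -
  have "\<forall>k\<in>{0,1,2,3,4,5}. \<forall>l\<in>{0,1,2,3,4,5}. 0 \<le> A6 $$ (k, l) \<and> (A6 $$ (k, l) = 0 \<longleftrightarrow> k div 2 = l div 2)"
    by simp
  moreover have "n \<in> {0,1,2,3,4,5}" if "n < 6" for n :: nat using that by auto
  ultimately show "k < 6 \<Longrightarrow> l < 6 \<Longrightarrow> 0 \<le> A6 $$ (k, l)"
    "k < 6 \<Longrightarrow> l < 6 \<Longrightarrow> A6 $$ (k, l) = 0 \<longleftrightarrow> k div 2 = l div 2"
    by blast+
qed

section \<open>The tropical rank\<close>

lemma trop_nonsingular_A6: "\<not> trop_singular (submatrix A6 {0, 2, 4, 5} {0, 1, 2, 4})"
proof
  let ?I = "{0, 2, 4, 5 :: nat}" and ?J = "{0, 1, 2, 4 :: nat}"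
  assume "trop_singular (submatrix A6 ?I ?J)"
  then obtain f g where fg: "optimal_bij A6 ?I ?J f" "optimal_bij A6 ?I ?J g" "\<exists>i\<in>?I. f i \<noteq> g i"
    by (subst (asm) trop_singular_submatrix_iff) auto
  \<comment> \<open>The assignment \<open>?h\<close> below has weight \<open>2\<close>, so an optimal one avoids all entries \<open>4\<close>, which forces it.\<close>
  have *: "h 0 = 1 \<and> h 2 = 2 \<and> h 4 = 4 \<and> h 5 = 0" if "optimal_bij A6 ?I ?J h" for h
  proof -
    let ?h = "\<lambda>i::nat. if i = 0 then 1 else if i = 5 then 0 else i"
    have "bij_betw ?h ?I ?J" by (auto simp: bij_betw_def inj_on_def)
    then have "(\<Sum>i\<in>?I. A6 $$ (i, h i)) \<le> (\<Sum>i\<in>?I. A6 $$ (i, ?h i))"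
      using that unfolding optimal_bij_def by blast
    then have le: "A6 $$ (0, h 0) + A6 $$ (2, h 2) + A6 $$ (4, h 4) + A6 $$ (5, h 5) \<le> 2"
      by simp
    have bij: "bij_betw h ?I ?J" using that by (simp add: optimal_bij_def)
    have mem: "h i \<in> ?J" if "i \<in> ?I" for i by (rule bij_betw_apply[OF bij that])
    have inj: "h i \<noteq> h j" if "i \<in> ?I" "j \<in> ?I" "i \<noteq> j" for i j
      using inj_on_eq_iff[OF bij_betw_imp_inj_on[OF bij] that(1,2)] that(3) by simp
    have nonneg: "0 \<le> A6 $$ (i, h i)" if "i \<in> ?I" for i
      using that mem[OF that] by (intro A6_nonneg) auto
    have small: "A6 $$ (i, h i) \<le> 2" if "i \<in> ?I" for i
      using that le nonneg[of 0] nonneg[of 2] nonneg[of 4] nonneg[of 5] by (auto simp del: A6_index)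
    have "h 2 = 2" using small[of 2] mem[of 2] by auto
    moreover have "h 4 = 4" using small[of 4] mem[of 4] by auto
    ultimately have "h 5 = 0"
      using small[of 5] mem[of 5] inj[of 5 2] inj[of 5 4] by auto
    then have "h 0 = 1"
      using small[of 0] mem[of 0] inj[of 0 5] by auto
    show ?thesis by (intro conjI; fact)
  qed
  show False using *[OF fg(1)] *[OF fg(2)] fg(3) by auto
qed

text \<open>The smallest entry of the block with rows from \<open>a\<close> and columns from \<open>b\<close>.\<close>
definition block_dist :: "nat \<Rightarrow> nat \<Rightarrow> real" where
  "block_dist a b = (if a = b then 0 else A6 $$ (2 * a + 1, 2 * b))"

text \<open>For fixed \<open>c\<close>, the distance to \<open>c\<close> is a feasible potential; this is the triangle inequality
\<open>block_dist a c \<le> block_dist a b + block_dist b c\<close>, as \<open>block_dist a b\<close> is the least entry of its block.\<close>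
lemma block_dist_potential:
  assumes "k < 6" "l < 6" "c < 3"
  shows "block_dist (k div 2) c - block_dist (l div 2) c \<le> A6 $$ (k, l)"
proof -
  have "\<forall>k\<in>{0,1,2,3,4,5}. \<forall>l\<in>{0,1,2,3,4,5}. \<forall>c\<in>{0,1,2}.
      block_dist (k div 2) c - block_dist (l div 2) c \<le> A6 $$ (k, l)"
    by (simp add: block_dist_def)
  moreover have "k \<in> {0,1,2,3,4,5}" "l \<in> {0,1,2,3,4,5}" "c \<in> {0,1,2}" using assms by auto
  ultimately show ?thesis by blast
qed

text \<open>An assignment \<open>F\<close> of weight \<open>block_dist b a\<close> is optimal by the potential \<open>\<lambda>k. block_dist (k div 2) a\<close>, and it fixes a
block \<open>c\<close> other than \<open>a\<close> and \<open>b\<close>, where the four entries are zero and the columns can be exchanged.\<close>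
lemma trop_singular_A6_5:
  assumes ij: "i < 6" "j < 6"
  shows "trop_singular (submatrix A6 ({..<6} - {i}) ({..<6} - {j}))"
proof -
  let ?I = "{..<6} - {i}" and ?J = "{..<6} - {j}"
  define a where "a = i div 2"
  define b where "b = j div 2"
  \<comment> \<open>The three factors of \<open>F\<close> send \<open>i\<close> to \<open>2a\<close>, then to \<open>2b + 1\<close>, then to \<open>j\<close>. For \<open>a \<noteq> b\<close> the row \<open>2b + 1\<close>
    goes to the column \<open>2a\<close>, the small entry of its block, and every other row of \<open>?I\<close> stays in its block. For \<open>a = b\<close> no index leaves its block.\<close>
  define F where "F = transpose (2 * b + 1) j \<circ> transpose (2 * b + 1) (2 * a) \<circ> transpose (2 * a) i"
  have ab: "a < 3" "b < 3" using ij by (simp_all add: a_def b_def)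
  have F: "F permutes {..<6}" unfolding F_def
    using ij ab by (intro permutes_compose permutes_swap_id) auto
  have "F i = j" by (simp add: F_def)
  then have bij: "bij_betw F ?I ?J"
    using permutes_imp_bij[OF F] ij by (metis bij_betw_DiffI bij_betw_singletonI insert_subset lessThan_iff empty_subsetI)
  have cost: "A6 $$ (k, F k) = (if k = 2 * b + 1 then block_dist b a else 0)" if "k \<in> ?I" for k
  proof -
    have k: "k < 6" "k \<noteq> i" "F k < 6" using that permutes_in_image[OF F, of k] by auto
    show ?thesis
    proof (cases "k = 2 * b + 1 \<and> a \<noteq> b")
      case True
      then have "k \<noteq> 2 * a" "2 * a \<noteq> 2 * b + 1" by presburger+
      moreover have "2 * a \<noteq> j" using True by (auto simp: b_def)
      ultimately have "F k = 2 * a" using True k(2) by (simp add: F_def transpose_def)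
      then show ?thesis using True by (simp add: block_dist_def del: A6_index)
    next
      case False
      have block: "transpose x y l div 2 = l div 2" if "x div 2 = y div 2" for x y l :: nat
        using that by (simp add: transpose_def)
      let ?k = "transpose (2 * a) i k"
      have "transpose (2 * b + 1) (2 * a) ?k div 2 = ?k div 2"
      proof (cases "a = b")
        case True
        then show ?thesis by (intro block) simp
      next
        case neq: False
        have "?k \<noteq> 2 * a" using k(2) by (auto simp: transpose_def)
        moreover have "?k \<noteq> 2 * b + 1"
        proof
          assume "?k = 2 * b + 1"
          moreover from this have "k div 2 = b" using block[of "2 * a" i k] by (simp add: a_def)
          moreover from this have "k \<noteq> 2 * a" using neq by auto
          ultimately have "k = 2 * b + 1" using k(2) by (simp add: transpose_def)
          then show False using False neq by simp
        qed
        ultimately show ?thesis by (simp add: transpose_apply_other)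
      qed
      then have "F k div 2 = k div 2"
        unfolding F_def o_apply by (simp add: block a_def b_def)
      then show ?thesis using False k A6_eq_0_iff[of k "F k"] by (auto simp: block_dist_def simp del: A6_index)
    qed
  qed
  \<comment> \<open>If \<open>2b + 1 = i\<close>, then \<open>a = b\<close> and the bound is \<open>0\<close>.\<close>
  have weight: "(\<Sum>k\<in>?I. A6 $$ (k, F k)) \<le> block_dist b a"
  proof -
    have "(\<Sum>k\<in>?I. A6 $$ (k, F k)) = (\<Sum>k\<in>?I. if k = 2 * b + 1 then block_dist b a else 0)"
      by (intro sum.cong refl cost)
    also have "\<dots> \<le> block_dist b a"
      using ab by (simp add: a_def b_def block_dist_def)
    finally show ?thesis .
  qed
  have opt: "optimal_bij A6 ?I ?J F"
    unfolding optimal_bij_def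
  proof (intro conjI allI impI bij)
    fix h assume h: "bij_betw h ?I ?J"
    \<comment> \<open>The potential telescopes to its difference between \<open>j\<close> and \<open>i\<close>, because \<open>?I\<close> and \<open>?J\<close> differ only there.\<close>
    let ?p = "\<lambda>k. block_dist (k div 2) a"
    have "(\<Sum>k<6. ?p k) = ?p i + (\<Sum>k\<in>?I. ?p k)" "(\<Sum>k<6. ?p k) = ?p j + (\<Sum>k\<in>?J. ?p k)"
      using ij by (intro sum.remove; simp)+
    then have "block_dist b a = (\<Sum>k\<in>?I. ?p k) - (\<Sum>k\<in>?J. ?p k)"
      by (simp add: a_def b_def block_dist_def)
    also have "\<dots> \<le> (\<Sum>k\<in>?I. A6 $$ (k, h k))"
    proof (rule bij_betw_sum_potential[OF h])
      fix k assume k: "k \<in> ?I"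
      then have "h k \<in> ?J" using h bij_betwE by blast
      then show "?p k - ?p (h k) \<le> A6 $$ (k, h k)"
        using k ab by (intro block_dist_potential) auto
    qed
    finally show "(\<Sum>k\<in>?I. A6 $$ (k, F k)) \<le> (\<Sum>k\<in>?I. A6 $$ (k, h k))" using weight by linarith
  qed
  obtain c where c: "c < 3" "c \<noteq> a" "c \<noteq> b"
  proof -
    have "\<exists>c<3. c \<noteq> a \<and> c \<noteq> b"
      by (rule exI[of _ "if a \<noteq> 0 \<and> b \<noteq> 0 then 0 else if a \<noteq> 1 \<and> b \<noteq> 1 then 1 else 2"]) auto
    then show thesis using that by blast
  qed
  have neq: "2 * c \<noteq> i" "2 * c + 1 \<noteq> i" "2 * c \<noteq> j" "2 * c + 1 \<noteq> j" "2 * c \<noteq> 2 * a" "2 * c + 1 \<noteq> 2 * a"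
    "2 * c \<noteq> 2 * b + 1" "2 * c + 1 \<noteq> 2 * b + 1"
    using c by (auto simp: a_def b_def)
  then have Fc: "F (2 * c) = 2 * c" "F (2 * c + 1) = 2 * c + 1"
    by (simp_all only: F_def o_apply transpose_apply_other not_False_eq_True)
  have zero: "A6 $$ (k, l) = 0" if "k \<in> {2 * c, 2 * c + 1}" "l \<in> {2 * c, 2 * c + 1}" for k l
    using that c(1) by (subst A6_eq_0_iff) auto
  show ?thesis
  proof (rule trop_singular_swap[OF _ _ opt])
    show "2 * c \<in> ?I" "2 * c + 1 \<in> ?I" using c(1) neq by auto
    show "A6 $$ (2 * c, F (2 * c)) + A6 $$ (2 * c + 1, F (2 * c + 1)) =
        A6 $$ (2 * c, F (2 * c + 1)) + A6 $$ (2 * c + 1, F (2 * c))"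
      unfolding Fc by (simp only: zero insert_iff simp_thms)
  qed auto
qed

lemma trop_singular_A6_6: "trop_singular (submatrix A6 {..<6} {..<6})"
proof (rule trop_singular_swap)
  have six: "{..<6} = {0, 1, 2, 3, 4, 5 :: nat}" by auto
  have "(\<Sum>k<6. A6 $$ (k, id k)) = 0" by (simp add: six)
  moreover have "0 \<le> (\<Sum>k<6. A6 $$ (k, h k))" if "bij_betw h {..<6} {..<6}" for h
    using bij_betwE[OF that] by (intro sum_nonneg A6_nonneg) auto
  ultimately show "optimal_bij A6 {..<6} {..<6} id"
    by (auto simp: optimal_bij_def simp del: id_apply)
  show "(0::nat) \<in> {..<6}" "(1::nat) \<in> {..<6}" by auto
qed auto

lemma trop_rank_A6: "trop_rank A6 = 4"
  unfolding trop_rank_def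
proof (rule Max_eqI)
  let ?R = "{r. \<exists>I J. I \<subseteq> {..<dim_row A6} \<and> J \<subseteq> {..<dim_col A6} \<and>
                          card I = r \<and> card J = r \<and> \<not> trop_singular (submatrix A6 I J)}"
  have card_le: "card I \<le> 6" if "I \<subseteq> {..<6}" for I :: "nat set"
    using card_mono[OF _ that] by simp
  have "?R \<subseteq> {..6}" unfolding dim_A6 using card_le by auto
  then show "finite ?R" by (rule finite_subset) simp
  show "4 \<in> ?R" unfolding dim_A6 using trop_nonsingular_A6
    by (intro CollectI exI[of _ "{0, 2, 4, 5}"] exI[of _ "{0, 1, 2, 4}"]) auto
  fix r assume "r \<in> ?R"
  then obtain I J where IJ: "I \<subseteq> {..<6}" "J \<subseteq> {..<6}" "card I = r" "card J = r"
    and nonsing: "\<not> trop_singular (submatrix A6 I J)"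
    unfolding dim_A6 by blast
  have full: "K = {..<6}" if "K \<subseteq> {..<6}" "card K = 6" for K :: "nat set"
    using card_subset_eq[of "{..<6}" K] that by simp
  have co1: "\<exists>k<6. K = {..<6} - {k}" if "K \<subseteq> {..<6}" "card K = 5" for K :: "nat set"
  proof -
    have "finite K" using that(1) by (rule finite_subset) simp
    then have "card ({..<6} - K) = 1" using that by (simp add: card_Diff_subset)
    then obtain k where "{..<6} - K = {k}" by (auto simp: card_1_singleton_iff)
    then show ?thesis using that(1) by blast
  qed
  show "r \<le> 4"
  proof (rule ccontr)
    assume "\<not> r \<le> 4"
    moreover have "r \<le> 6" using card_le IJ by blast
    ultimately consider "r = 5" | "r = 6" by linarith
    then show False
    proof cases
      case 1
      then show False using co1 IJ nonsing trop_singular_A6_5 by metis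
    next
      case 2
      then show False using full IJ nonsing trop_singular_A6_6 by metis
    qed
  qed
qed

section \<open>The Kapranov rank\<close>

text \<open>The even indices \<open>p\<close>, \<open>q\<close>, \<open>s\<close> and the odd ones \<open>p'\<close>, \<open>q'\<close>, \<open>s'\<close> stand for the three blocks, and the
vector \<open>x\<close> has coordinate zero at \<open>s'\<close>. Modulo terms of degree \<open>4\<close> above the least degree of \<open>x\<close>, the row \<open>s\<close>
says that \<open>x s\<close> vanishes, the rows \<open>p\<close> and \<open>q\<close> that \<open>x p'\<close> and \<open>x q'\<close> are unit multiples of \<open>x p\<close> and \<open>x q\<close>,
and the row \<open>s'\<close> then balances \<open>\<alpha>\<close> plus the degree of \<open>x p\<close> against \<open>\<beta>\<close> plus the degree of \<open>x q\<close>.\<close>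
lemma kernel_deg_quotient:
  fixes b :: "nat \<Rightarrow> nat \<Rightarrow> series" and x :: "nat \<Rightarrow> series"
  assumes eq: "\<And>i. i \<in> {p, q, s, s'} \<Longrightarrow>
      b i p * x p + b i p' * x p' + b i q * x q + b i q' * x q' + b i s * x s = 0"
    and nz: "\<exists>j\<in>{p, p', q, q', s}. x j \<noteq> 0"
    and p: "series_deg (b p p) = ereal 0" "series_deg (b p p') = ereal 0"
      "le_deg 4 (b p q)" "le_deg 4 (b p q')" "le_deg 4 (b p s)"
    and q: "series_deg (b q q) = ereal 0" "series_deg (b q q') = ereal 0"
      "le_deg 4 (b q p)" "le_deg 4 (b q p')" "le_deg 4 (b q s)"
    and s: "series_deg (b s s) = ereal 0"
      "le_deg 4 (b s p)" "le_deg 4 (b s p')" "le_deg 4 (b s q)" "le_deg 4 (b s q')"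
    and s': "series_deg (b s' p) = ereal \<alpha>" "series_deg (b s' q) = ereal \<beta>"
      "le_deg 4 (b s' p')" "le_deg 4 (b s' q')" "le_deg 0 (b s' s)"
    and \<alpha>\<beta>: "0 \<le> \<alpha>" "\<alpha> < 4" "0 \<le> \<beta>" "\<beta> < 4"
  obtains m n where "series_deg (x p') = ereal m" "series_deg (x q') = ereal n" "n - m = \<alpha> - \<beta>"
proof -
  let ?J = "{p, p', q, q', s}"
  \<comment> \<open>The least degree \<open>m\<close> of a coordinate; everything of degree at least \<open>4 + m\<close> is negligible.\<close>
  obtain m where ge: "\<And>j. j \<in> ?J \<Longrightarrow> le_deg m (x j)" and ex: "\<exists>j\<in>?J. series_deg (x j) = ereal m"
  proof -
    let ?D = "(\<lambda>j. series_deg (x j)) ` ?J"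
    obtain j0 where j0: "j0 \<in> ?J" "series_deg (x j0) = Min ?D"
      using Min_in[of ?D] by (metis (no_types, lifting) finite.emptyI finite.insertI finite_imageI
          image_iff image_is_empty insert_not_empty)
    have min: "series_deg (x j0) \<le> series_deg (x j)" if "j \<in> ?J" for j
      unfolding j0(2) using that by (intro Min_le) auto
    have "x j0 \<noteq> 0"
    proof
      assume "x j0 = 0"
      then have "series_deg (x j) = \<infinity>" if "j \<in> ?J" for j
        using min[OF that] by (simp add: series_deg_def split: if_splits)
      then have "x j = 0" if "j \<in> ?J" for j
        using that by (metis PInfty_neq_ereal(1) series_deg_def)
      then show False using nz by blast
    qed
    then obtain m where m: "series_deg (x j0) = ereal m" by (rule series_deg_finite)
    have "le_deg m (x j)" if j: "j \<in> ?J" for j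
    proof (cases "x j = 0")
      case False
      then obtain r where r: "series_deg (x j) = ereal r" by (rule series_deg_finite)
      have "m \<le> r" using min[OF j] r m by simp
      then show ?thesis using le_deg_mono le_deg_series_deg[OF r] by blast
    qed simp
    then show thesis using that m j0(1) by blast
  qed
  have small: "le_deg (4 + m) (c * x j)" if "le_deg 4 c" "j \<in> ?J" for c j
    using le_deg_mult ge that by blast
  have xs: "le_deg (4 + m) (x s)"
  proof (rule le_deg_mult_cancel[OF s(1)])
    have "b s s * x s = - (b s p * x p + b s p' * x p' + b s q * x q + b s q' * x q')"
      using eq[of s] by (simp add: eq_neg_iff_add_eq_0 algebra_simps)
    moreover have "le_deg (4 + m) (- (b s p * x p + b s p' * x p' + b s q * x q + b s q' * x q'))"
      unfolding le_deg_uminus using s(2-5) by (intro le_deg_add small) simp_all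
    ultimately show "le_deg (0 + (4 + m)) (b s s * x s)" by simp
  qed
  have P: "le_deg (4 + m) (b p p * x p + b p p' * x p')"
  proof -
    have "b p p * x p + b p p' * x p' = - (b p q * x q + b p q' * x q' + b p s * x s)"
      using eq[of p] by (simp add: eq_neg_iff_add_eq_0 algebra_simps)
    then show ?thesis using p(3-5) by (simp only: le_deg_uminus) (intro le_deg_add small; simp)
  qed
  have Q: "le_deg (4 + m) (b q q * x q + b q q' * x q')"
  proof -
    have "b q q * x q + b q q' * x q' = - (b q p * x p + b q p' * x p' + b q s * x s)"
      using eq[of q] by (simp add: eq_neg_iff_add_eq_0 algebra_simps)
    then show ?thesis using q(3-5) by (simp only: le_deg_uminus) (intro le_deg_add small; simp)
  qed
  have S: "le_deg (4 + m) (b s' p * x p + b s' q * x q)"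
  proof -
    have "b s' p * x p + b s' q * x q = - (b s' p' * x p' + b s' q' * x q' + b s' s * x s)"
      using eq[of s'] by (simp add: eq_neg_iff_add_eq_0 algebra_simps)
    moreover have "le_deg (4 + m) (b s' s * x s)" using le_deg_mult[OF s'(5) xs] by simp
    ultimately show ?thesis using s'(3,4) by (simp only: le_deg_uminus) (intro le_deg_add; (assumption | (rule small; simp)))
  qed
  have P': "le_deg (4 + m) (b p p' * x p' + b p p * x p)"
    and Q': "le_deg (4 + m) (b q q' * x q' + b q q * x q)"
    and S': "le_deg (4 + m) (b s' q * x q + b s' p * x p)"
    using P Q S by (simp_all add: add.commute)
  \<comment> \<open>The coordinate \<open>s\<close> is negligible, and the rows \<open>p\<close>, \<open>q\<close> tie each odd coordinate to its even partner.\<close>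
  have "series_deg (x s) \<noteq> ereal m"
    using xs by (auto simp: series_deg_eq_iff le_deg_def)
  then have "series_deg (x p) = ereal m \<or> series_deg (x q) = ereal m"
    using ex series_deg_balance[OF p(2,1) _ P'] series_deg_balance[OF q(2,1) _ Q'] by auto
  then show thesis
  proof
    assume xp: "series_deg (x p) = ereal m"
    have xq: "series_deg (x q) = ereal (\<alpha> + m - \<beta>)"
      using series_deg_balance[OF s'(1,2) xp S] \<alpha>\<beta> by simp
    have "series_deg (x p') = ereal m" "series_deg (x q') = ereal (\<alpha> + m - \<beta>)"
      using series_deg_balance[OF p(1,2) xp P] series_deg_balance[OF q(1,2) xq Q] \<alpha>\<beta> by simp_all
    then show thesis by (rule that) simp
  next
    assume xq: "series_deg (x q) = ereal m"
    have xp: "series_deg (x p) = ereal (\<beta> + m - \<alpha>)"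
      using series_deg_balance[OF s'(2,1) xq S'] \<alpha>\<beta> by simp
    have "series_deg (x p') = ereal (\<beta> + m - \<alpha>)" "series_deg (x q') = ereal m"
      using series_deg_balance[OF p(1,2) xp P] series_deg_balance[OF q(1,2) xq Q] \<alpha>\<beta> by simp_all
    then show thesis by (rule that) simp
  qed
qed

text \<open>If the rank were at most four, there would be a vector \<open>y\<close> orthogonal to the rows \<open>0, 1, 2, 4, 5\<close> with coordinate zero at \<open>5\<close>,
and a vector \<open>z\<close> orthogonal to the rows \<open>0, 1, 2, 3, 4\<close> with coordinate zero at \<open>3\<close>. By \<open>kernel_deg_quotient\<close>
the degree of \<open>y 3 / y 1\<close> is \<open>1\<close> and that of \<open>z 5 / z 1\<close> is \<open>0\<close>. The combination \<open>w\<close> with coordinate zero at \<open>1\<close> is orthogonal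
to the rows \<open>0, 1, 2, 4\<close>, so \<open>w 5 / w 3\<close> has degree \<open>1\<close>; but up to sign it is \<open>(z 5 / z 1) / (y 3 / y 1)\<close>, of degree \<open>-1\<close>.\<close>
lemma rank_lift_A6_ge_5:
  assumes "is_lift B A6"
  shows "5 \<le> vec_space.rank 6 B"
proof (rule ccontr)
  assume "\<not> ?thesis"
  then have rank: "vec_space.rank 6 B < 5" by simp
  have B: "B \<in> carrier_mat 6 6"
    using assms by (auto simp: is_lift_def)
  define b where "b i j = B $$ (i, j)" for i j
  have deg: "series_deg (b i j) = ereal (A6 $$ (i, j))" if "i < 6" "j < 6" for i j
    using assms that by (simp add: is_lift_def b_def del: A6_index)
  have le: "le_deg c (b i j)" if "i < 6" "j < 6" "A6 $$ (i, j) = c" for i j c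
    using le_deg_series_deg deg that by blast
  obtain y where y: "\<And>i. i \<in> {0,1,2,4,5} \<Longrightarrow> (\<Sum>j\<in>{0,1,2,3,4}. b i j * y j) = 0"
    "\<exists>j\<in>{0,1,2,3,4}. y j \<noteq> 0"
    by (rule zero_rank_submatrix[OF B, of "{0,1,2,4,5}" "{0,1,2,3,4}"])
      (use rank in \<open>auto simp: b_def\<close>)
  obtain z where z: "\<And>i. i \<in> {0,1,2,3,4} \<Longrightarrow> (\<Sum>j\<in>{0,1,2,4,5}. b i j * z j) = 0"
    "\<exists>j\<in>{0,1,2,4,5}. z j \<noteq> 0"
    by (rule zero_rank_submatrix[OF B, of "{0,1,2,3,4}" "{0,1,2,4,5}"])
      (use rank in \<open>auto simp: b_def\<close>)
  obtain m n where y13: "series_deg (y 1) = ereal m" "series_deg (y 3) = ereal n" "n - m = 2 - 1"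
  proof (rule kernel_deg_quotient[where b = b and x = y and p = 0 and p' = 1 and q = 2 and q' = 3 and s = 4 and s' = 5
        and \<alpha> = 2 and \<beta> = 1])
    show "b i 0 * y 0 + b i 1 * y 1 + b i 2 * y 2 + b i 3 * y 3 + b i 4 * y 4 = 0" 
      if "i \<in> {0, 2, 4, 5}" for i
      using y(1)[of i] that by (auto simp: algebra_simps)
    show "\<exists>j\<in>{0, 1, 2, 3, 4}. y j \<noteq> 0" by (fact y(2))
  qed (rule that; assumption | simp add: deg le)+
  obtain k l where z15: "series_deg (z 1) = ereal k" "series_deg (z 5) = ereal l" "l - k = 2 - 2"
  proof (rule kernel_deg_quotient[where b = b and x = z and p = 0 and p' = 1 and q = 4 and q' = 5 and s = 2 and s' = 3
        and \<alpha> = 2 and \<beta> = 2])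
    show "b i 0 * z 0 + b i 1 * z 1 + b i 4 * z 4 + b i 5 * z 5 + b i 2 * z 2 = 0"
      if "i \<in> {0, 4, 2, 3}" for i
      using z(1)[of i] that by (auto simp: algebra_simps)
    show "\<exists>j\<in>{0, 1, 4, 5, 2}. z j \<noteq> 0" using z(2) by blast
  qed (rule that; assumption | simp add: deg le)+
  \<comment> \<open>Cross-multiplication makes the coordinate \<open>1\<close> of \<open>w\<close> vanish; the coordinates at which \<open>y\<close> and \<open>z\<close>
    are unspecified are read as zero.\<close>
  define w where "w j = (if j = 5 then 0 else y j) * z 1 - (if j = 3 then 0 else z j) * y 1" for j :: nat
  have w3: "series_deg (w 3) = ereal (n + k)"
    using series_deg_mult[OF y13(2) z15(1)] by (simp add: w_def)
  have w5: "series_deg (w 5) = ereal (l + m)"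
    using series_deg_mult[OF z15(2) y13(1)] by (simp add: w_def)
  obtain m' n' where w35: "series_deg (w 3) = ereal m'" "series_deg (w 5) = ereal n'" "n' - m' = 2 - 1"
  proof (rule kernel_deg_quotient[where b = b and x = w and p = 2 and p' = 3 and q = 4 and q' = 5 and s = 0 and s' = 1
        and \<alpha> = 2 and \<beta> = 1])
    show "b i 2 * w 2 + b i 3 * w 3 + b i 4 * w 4 + b i 5 * w 5 + b i 0 * w 0 = 0"
      if "i \<in> {2, 4, 0, 1}" for i
    proof -
      have "b i 2 * w 2 + b i 3 * w 3 + b i 4 * w 4 + b i 5 * w 5 + b i 0 * w 0
        = (\<Sum>j\<in>{0,1,2,3,4}. b i j * y j) * z 1 - (\<Sum>j\<in>{0,1,2,4,5}. b i j * z j) * y 1"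
        by (simp add: w_def algebra_simps)
      also have "\<dots> = 0"
      proof -
        have "i \<in> {0,1,2,4,5}" "i \<in> {0,1,2,3,4}" using that by auto
        then show ?thesis by (simp only: y(1) z(1) mult_zero_left diff_self)
      qed
      finally show ?thesis .
    qed
    show "\<exists>j\<in>{2, 3, 4, 5, 0}. w j \<noteq> 0"
      using w3 by (intro bexI[of _ 3]) (auto simp: series_deg_def)
  qed (rule that; assumption | simp add: deg le)+
  have "m' = n + k" "n' = l + m" using w3 w5 w35(1,2) by simp_all
  then show False using y13(3) z15(3) w35(3) by linarith
qed

text \<open>In each column the entries are chosen as pure powers, except one that is the negative sum of the
others. The rows then add up to zero.\<close>
lemma singular_lift_A6:
  obtains B where "is_lift B A6" "vec_space.rank 6 B < 6"
proof -
  define r :: "nat \<Rightarrow> nat" where "r j = 2 * (j div 2) + 1" for j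
  have r_less: "r j < 6" if "j < 6" for j using that unfolding r_def by presburger
  \<comment> \<open>Row \<open>r j\<close> holds one of the two zeros of column \<open>j\<close>. The other zero gives the sum of the
    remaining entries degree \<open>0\<close>, as the entry of the lift at \<open>(r j, j)\<close> requires.\<close>
  define c where "c i j = series_single (A6 $$ (i, j)) 1" for i j
  define B where "B = mat 6 6 (\<lambda>(i, j). if i = r j then - (\<Sum>k\<in>{..<6} - {r j}. c k j) else c i j)"
  have B: "B \<in> carrier_mat 6 6" by (simp add: B_def)
  have deg_c: "series_deg (c i j) = ereal (A6 $$ (i, j))" for i j
    by (simp add: c_def series_deg_eq_iff le_deg_def series_single.rep_eq)
  have deg_r: "series_deg (\<Sum>k\<in>{..<6} - {r j}. c k j) = ereal (A6 $$ (r j, j))" if "j < 6" for j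
  proof -
    let ?s = "\<Sum>k\<in>{..<6} - {r j}. c k j"
    have r: "A6 $$ (r j, j) = 0"
      using that r_less[OF that] A6_eq_0_iff[of "r j" j] by (simp add: r_def del: A6_index)
    have "series_nth ?s 0 = (\<Sum>k\<in>{..<6} - {r j}. if k = 2 * (j div 2) then 1 else 0)"
      unfolding series_nth_sum
    proof (intro sum.cong refl)
      fix k assume k: "k \<in> {..<6} - {r j}"
      have "k div 2 = j div 2 \<longleftrightarrow> k = 2 * (j div 2)"
        using k by (auto simp: r_def)
      then have "A6 $$ (k, j) = 0 \<longleftrightarrow> k = 2 * (j div 2)"
        using k that A6_eq_0_iff[of k j] by (simp del: A6_index)
      then show "series_nth (c k j) 0 = (if k = 2 * (j div 2) then 1 else 0)"
        by (auto simp: c_def series_single.rep_eq simp del: A6_index)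
    qed
    also have "\<dots> = 1" using that by (auto simp: r_def)
    finally have "series_nth ?s 0 \<noteq> 0" by simp
    moreover have "le_deg 0 ?s"
      unfolding le_deg_def series_nth_sum
    proof (intro allI impI sum.neutral ballI)
      fix x :: real and k assume "x < 0" "k \<in> {..<6} - {r j}"
      then show "series_nth (c k j) x = 0"
        using A6_nonneg[of k j] that by (simp add: c_def series_single.rep_eq del: A6_index)
    qed
    ultimately show ?thesis unfolding r series_deg_eq_iff ..
  qed
  have "is_lift B A6"
    using deg_c deg_r by (auto simp: is_lift_def B_def simp del: A6_index)
  moreover have "det B = 0"
  proof -
    have "transpose_mat B *\<^sub>v vec 6 (\<lambda>_. 1) = 0\<^sub>v 6"
    proof (rule eq_vecI)
      fix j assume "j < dim_vec (0\<^sub>v 6 :: series vec)"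
      then have j: "j < 6" by simp
      have rj: "r j < 6" using j by (rule r_less)
      have "(transpose_mat B *\<^sub>v vec 6 (\<lambda>_. 1)) $ j = (\<Sum>i<6. B $$ (i, j))"
        using B j by (simp add: scalar_prod_def lessThan_atLeast0)
      also have "\<dots> = B $$ (r j, j) + (\<Sum>i\<in>{..<6} - {r j}. B $$ (i, j))"
        using rj by (intro sum.remove) auto
      also have "(\<Sum>i\<in>{..<6} - {r j}. B $$ (i, j)) = (\<Sum>i\<in>{..<6} - {r j}. c i j)"
        using j by (intro sum.cong) (auto simp: B_def)
      finally show "(transpose_mat B *\<^sub>v vec 6 (\<lambda>_. 1)) $ j = 0\<^sub>v 6 $ j"
        using j rj by (simp add: B_def)
    qed (use B in simp)
    moreover have "vec 6 (\<lambda>_. 1) \<noteq> (0\<^sub>v 6 :: series vec)"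
      by (metis index_vec index_zero_vec(1) zero_less_numeral zero_neq_one)
    ultimately have "det (transpose_mat B) = 0"
      using B by (subst det_0_iff_vec_prod_zero[of _ 6]) (auto intro!: exI[of _ "vec 6 (\<lambda>_. 1)"])
    then show ?thesis using det_transpose[OF B] by simp
  qed
  ultimately show thesis using that vec_space.det_zero_low_rank[OF B] by blast
qed

lemma kapranov_rank_A6: "kapranov_rank A6 = 5"
  unfolding kapranov_rank_def
proof (rule Least_equality)
  have dim: "dim_row B = 6" if "is_lift B A6" for B
    using that by (simp add: is_lift_def)
  obtain B where B: "is_lift B A6" "vec_space.rank 6 B < 6" by (rule singular_lift_A6)
  then have "vec_space.rank 6 B = 5" using rank_lift_A6_ge_5[OF B(1)] by simp
  then show "\<exists>B. is_lift B A6 \<and> vec_space.rank (dim_row B) B = 5"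
    using B(1) dim by metis
  show "5 \<le> r" if "\<exists>B. is_lift B A6 \<and> vec_space.rank (dim_row B) B = r" for r
    using that rank_lift_A6_ge_5 dim by metis
qed

theorem mainTheorem1:
  fixes A :: "real mat"
  assumes "A = mat_of_rows_list 6
    [[0, 0, 4, 4, 4, 4],
     [0, 0, 2, 4, 1, 4],
     [4, 4, 0, 0, 4, 4],
     [2, 4, 0, 0, 2, 4],
     [4, 4, 4, 4, 0, 0],
     [2, 4, 1, 4, 0, 0]]"
  shows "trop_rank A = 4 \<and> kapranov_rank A = 5"
  unfolding assms A6_def[symmetric] using trop_rank_A6 kapranov_rank_A6 by blast

end
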